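(* Let $n,m,s,r\ge1$ be integers with $r<ns$, and let $$\hat{E}\dot{\hat{v}}=(\hat{J}-\hat{R})\hat{v}+(\hat{B}-\hat{P})\hat{u},\qquad \hat{w}=(\hat{B}+\hat{P})^\top\hat{v}+(\hat{S}+\hat{N})\hat{u}$$ be a port-Hamiltonian system with $\hat{Q}=I_{ns}$, where $\hat{E},\hat{J},\hat{R}\in\mathbb{R}^{ns\times ns}$, $\hat{B},\hat{P}\in\mathbb{R}^{ns\times ms}$, $\hat{S},\hat{N}\in\mathbb{R}^{ms\times ms}$, with Hamiltonian function $\hat{H}(\hat{v})=\tfrac12\hat{v}^\top\hat{E}\hat{v}$. Let $V\in\mathbb{R}^{ns\times r}$ satisfy $V^\top V=I_r$, and define $\bar{E}=V^\top\hat{E}V$, $\bar{J}=V^\top\hat{J}V$, $\bar{R}=V^\top\hat{R}V$, $\bar{B}=V^\top\hat{B}$, $\bar{P}=V^\top\hat{P}$. Then the reduced system (obtained by Galerkin-type model order reduction with projection matrix $V$) $$\bar{E}\dot{\bar{v}}=(\bar{J}-\bar{R})\bar{v}+(\bar{B}-\bar{P})\hat{u},\qquad \bar{w}=(\bar{B}+\bar{P})^\top\bar{v}+(\hat{S}+\hat{N})\hat{u}$$ with state $\bar v(t)\in\mathbb{R}^r$ is again a port-Hamiltonian system (with $\bar{Q}=I_r$), and its Hamiltonian function $\bar{H}$ satisfies $$\bar{H}(\bar{v})=\hat{H}(V\bar{v})\qquad\text{for all }\bar{v}\in\mathbb{R}^r.$$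
   Context: **Port-Hamiltonian (pH) system.** $\mathcal{S}^n_{\succeq}$ denotes the set of real symmetric positive semi-definite $n\times n$ matrices. A linear first-order pH system has the form $$E\dot{x}=(J-R)Qx+(B-P)u,\qquad y=(B+P)^\top Qx+(S+N)u$$ with $E,J,R,Q\in\mathbb{R}^{n\times n}$, $B,P\in\mathbb{R}^{n\times m}$, $S,N\in\mathbb{R}^{m\times m}$ such that $J$ and $N$ are skew-symmetric, $E^\top Q\in\mathcal{S}^n_{\succeq}$, and $$\begin{pmatrix}Q^\top RQ & Q^\top P\\ P^\top Q & S\end{pmatrix}\in\mathcal{S}^{n+m}_{\succeq}.$$ Its Hamiltonian function is $H(x)=\tfrac12x^\top(E^\top Q)x$. In the claim these definitions are applied with the dimensions indicated there. (In the application, the full-order system is a stochastic Galerkin system with $s$ modes obtained from a parameter-dependent pH system with $n$ states and $m$ inputs.) **Galerkin-type model order reduction.** Projection-based reduction with a single matrix $V$ having orthonormal columns, used for both left and right projection. *)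

theory Defs
  imports "HOL-Analysis.Analysis"
begin

definition pos_semidef :: "real ^ 'k ^ 'k \<Rightarrow> bool" where
  "pos_semidef A \<longleftrightarrow> transpose A = A \<and> (\<forall>x. 0 \<le> x \<bullet> (A *v x))"

definition skew_symmetric :: "real ^ 'k ^ 'k \<Rightarrow> bool" where
  "skew_symmetric A \<longleftrightarrow> transpose A = - A"

definition block_matrix ::
  "real ^ 'n ^ 'n \<Rightarrow> real ^ 'm ^ 'n \<Rightarrow> real ^ 'n ^ 'm \<Rightarrow> real ^ 'm ^ 'm
    \<Rightarrow> real ^ ('n + 'm) ^ ('n + 'm)" where
  "block_matrix A B C D = (\<chi> i j.
     (case i of
        Inl a \<Rightarrow> (case j of Inl b \<Rightarrow> A $ a $ b | Inr b \<Rightarrow> B $ a $ b)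
      | Inr a \<Rightarrow> (case j of Inl b \<Rightarrow> C $ a $ b | Inr b \<Rightarrow> D $ a $ b)))"

text \<open>The descriptor system \<open>E x' = A x + B u\<close>, \<open>y = C x + D u\<close> with state space
  \<open>real ^ 'n\<close> and as many outputs as inputs, given by its coefficient matrices
  (\<open>E\<close> may be singular).\<close>

record ('n::finite, 'm::finite) descriptor_system =
  mat_E :: "real ^ 'n ^ 'n"
  mat_A :: "real ^ 'n ^ 'n"
  mat_B :: "real ^ 'm ^ 'n"
  mat_C :: "real ^ 'n ^ 'm"
  mat_D :: "real ^ 'm ^ 'm"

text \<open>The system \<open>E x' = (J - R) Q x + (B - P) u\<close>, \<open>y = (B + P)\<^sup>T Q x + (S + N) u\<close>,
  without any structural condition on the matrices.\<close>

definition ph_form ::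
  "real ^ 'n ^ 'n \<Rightarrow> real ^ 'n ^ 'n \<Rightarrow> real ^ 'n ^ 'n \<Rightarrow> real ^ 'n ^ 'n
    \<Rightarrow> real ^ 'm ^ 'n \<Rightarrow> real ^ 'm ^ 'n \<Rightarrow> real ^ 'm ^ 'm \<Rightarrow> real ^ 'm ^ 'm
    \<Rightarrow> ('n::finite, 'm::finite) descriptor_system" where
  "ph_form E J R Q B P S N =
     \<lparr> mat_E = E,
       mat_A = (J - R) ** Q,
       mat_B = B - P,
       mat_C = transpose (B + P) ** Q,
       mat_D = S + N \<rparr>"

text \<open>A system is port-Hamiltonian relative to a choice of the matrices in its
  port-Hamiltonian form: the coefficients of the system do not determine them,
  and the Hamiltonian depends on \<open>Q\<close>.\<close>

definition port_hamiltonian ::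
  "('n::finite, 'm::finite) descriptor_system
    \<Rightarrow> real ^ 'n ^ 'n \<Rightarrow> real ^ 'n ^ 'n \<Rightarrow> real ^ 'n ^ 'n \<Rightarrow> real ^ 'n ^ 'n
    \<Rightarrow> real ^ 'm ^ 'n \<Rightarrow> real ^ 'm ^ 'n \<Rightarrow> real ^ 'm ^ 'm \<Rightarrow> real ^ 'm ^ 'm \<Rightarrow> bool" where
  "port_hamiltonian \<Sigma> E J R Q B P S N \<longleftrightarrow>
     \<Sigma> = ph_form E J R Q B P S N \<and>
     skew_symmetric J \<and> skew_symmetric N \<and>
     pos_semidef (transpose E ** Q) \<and>
     pos_semidef (block_matrix (transpose Q ** R ** Q) (transpose Q ** P)
                               (transpose P ** Q)      S)"

definition hamiltonian :: "real ^ 'n ^ 'n \<Rightarrow> real ^ 'n ^ 'n \<Rightarrow> real ^ 'n \<Rightarrow> real" where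
  "hamiltonian E Q x = 1 / 2 * (x \<bullet> ((transpose E ** Q) *v x))"

text \<open>Substitute \<open>x = V z\<close> and multiply the state equation by \<open>V\<^sup>T\<close> from the left.\<close>

definition galerkin_reduction ::
  "real ^ 'r ^ 'n \<Rightarrow> ('n::finite, 'm::finite) descriptor_system
    \<Rightarrow> ('r::finite, 'm) descriptor_system" where
  "galerkin_reduction V \<Sigma> =
     \<lparr> mat_E = transpose V ** mat_E \<Sigma> ** V,
       mat_A = transpose V ** mat_A \<Sigma> ** V,
       mat_B = transpose V ** mat_B \<Sigma>,
       mat_C = mat_C \<Sigma> ** V,
       mat_D = mat_D \<Sigma> \<rparr>"

end

theory Submission
  imports Defs
begin

text \<open>With \<open>Q\<close> the identity, Galerkin projection acts on the structural matrices
  by congruence: \<open>J\<close>, \<open>R\<close> and \<open>E\<close> become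
  \<open>transpose V ** X ** V\<close>, and the block matrix of \<open>R\<close>, \<open>P\<close>,
  \<open>S\<close> is transformed by diag(V, I). Congruence preserves skew-symmetry, symmetry and,
  since the new quadratic form at x is the old one at V x, nonnegativity; \<open>N\<close> is
  unchanged. The same substitution in the form of \<open>E\<close> is the Hamiltonian identity. The
  weight is carried by \<open>inner_congruence\<close>,
  \<open>pos_semidef_block_matrix_congruence\<close> and
  \<open>galerkin_reduction_ph_form\<close>.\<close>

lemma inner_matrix_vector_transpose:
  fixes A :: "real ^ 'n ^ 'm"
  shows "x \<bullet> (A *v y) = (transpose A *v x) \<bullet> y"
  by (simp add: dot_lmul_matrix)

lemma transpose_plus_matrix: "transpose (A + B) = transpose A + transpose (B :: real ^ 'n ^ 'm)"
  by (simp add: transpose_def vec_eq_iff)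

lemma matrix_mult_minus_left: "(- A) ** B = - (A ** B)"
  for A :: "real ^ 'n ^ 'm" and B :: "real ^ 'k ^ 'n"
  by (simp add: matrix_matrix_mult_def vec_eq_iff sum_negf)

lemma matrix_mult_minus_right: "A ** (- B) = - (A ** B)"
  for A :: "real ^ 'n ^ 'm" and B :: "real ^ 'k ^ 'n"
  by (simp add: matrix_matrix_mult_def vec_eq_iff sum_negf)

lemma matrix_add_rdistrib: "(A + B) ** C = A ** C + B ** C"
  for A B :: "real ^ 'n ^ 'm" and C :: "real ^ 'k ^ 'n"
  by (simp add: matrix_matrix_mult_def vec_eq_iff distrib_right sum.distrib)

lemma matrix_diff_ldistrib: "A ** (B - C) = A ** B - A ** C"
  for A :: "real ^ 'n ^ 'm" and B C :: "real ^ 'k ^ 'n"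
  by (simp add: matrix_matrix_mult_def vec_eq_iff right_diff_distrib sum_subtractf)

lemma matrix_diff_rdistrib: "(A - B) ** C = A ** C - B ** C"
  for A B :: "real ^ 'n ^ 'm" and C :: "real ^ 'k ^ 'n"
  by (simp add: matrix_matrix_mult_def vec_eq_iff left_diff_distrib sum_subtractf)

lemma skew_symmetric_congruence:
  fixes A :: "real ^ 'n ^ 'n" and V :: "real ^ 'r ^ 'n"
  assumes "skew_symmetric A"
  shows "skew_symmetric (transpose V ** A ** V)"
  using assms
  by (simp add: skew_symmetric_def matrix_transpose_mul matrix_mul_assoc
      matrix_mult_minus_left matrix_mult_minus_right)

text \<open>\<open>transpose V\<close> is the adjoint of V. This one identity serves both the
  semidefiniteness conditions and the Hamiltonian.\<close>

lemma inner_congruence: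
  fixes A :: "real ^ 'n ^ 'n" and V :: "real ^ 'r ^ 'n"
  shows "x \<bullet> ((transpose V ** A ** V) *v y) = (V *v x) \<bullet> (A *v (V *v y))"
  by (simp only: inner_matrix_vector_transpose[of x "transpose V"] transpose_transpose
      matrix_vector_mul_assoc[symmetric])

lemma pos_semidef_congruence:
  fixes A :: "real ^ 'n ^ 'n" and V :: "real ^ 'r ^ 'n"
  assumes "pos_semidef A"
  shows "pos_semidef (transpose V ** A ** V)"
  using assms unfolding pos_semidef_def inner_congruence
  by (simp add: matrix_transpose_mul matrix_mul_assoc)

lemma transpose_block_matrix:
  "transpose (block_matrix A B C D)
     = block_matrix (transpose A) (transpose C) (transpose B) (transpose D)"
  by (simp add: block_matrix_def transpose_def vec_eq_iff split: sum.split)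

lemma block_matrix_eq_iff:
  "block_matrix A B C D = block_matrix A' B' C' D' \<longleftrightarrow> A = A' \<and> B = B' \<and> C = C' \<and> D = D'"
proof
  assume "block_matrix A B C D = block_matrix A' B' C' D'"
  then have eq: "block_matrix A B C D $ i $ j = block_matrix A' B' C' D' $ i $ j" for i j
    by simp
  show "A = A' \<and> B = B' \<and> C = C' \<and> D = D'"
    using eq[of "Inl _" "Inl _"] eq[of "Inl _" "Inr _"] eq[of "Inr _" "Inl _"] eq[of "Inr _" "Inr _"]
    by (simp add: block_matrix_def vec_eq_iff)
qed auto

text \<open>A sum over a sum type splits into its \<open>Inl\<close> and \<open>Inr\<close> parts,
  so the double sum falls into four blocks.\<close>

lemma inner_block_matrix:
  fixes A :: "real ^ 'n::finite ^ 'n" and D :: "real ^ 'm::finite ^ 'm"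
    and x :: "real ^ ('n + 'm)"
  defines "y \<equiv> \<chi> i. x $ Inl i" and "z \<equiv> \<chi> i. x $ Inr i"
  shows "x \<bullet> (block_matrix A B C D *v x)
     = y \<bullet> (A *v y) + y \<bullet> (B *v z) + z \<bullet> (C *v y) + z \<bullet> (D *v z)"
  unfolding y_def z_def
  by (simp add: inner_vec_def matrix_vector_mult_def block_matrix_def sum.Plus
      sum.distrib distrib_left flip: UNIV_Plus_UNIV)

text \<open>Since diag(V, I) is rectangular, it is not a \<open>block_matrix\<close>. In blockwise
  form, the congruence by it is just the substitution of V y for y with z kept.\<close>

lemma pos_semidef_block_matrix_iff:
  fixes A :: "real ^ 'n::finite ^ 'n" and D :: "real ^ 'm::finite ^ 'm"
  shows "pos_semidef (block_matrix A B C D) \<longleftrightarrow>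
    transpose A = A \<and> transpose B = C \<and> transpose D = D \<and>
    (\<forall>y z. 0 \<le> y \<bullet> (A *v y) + y \<bullet> (B *v z) + z \<bullet> (C *v y) + z \<bullet> (D *v z))"
    (is "_ \<longleftrightarrow> _ \<and> _ \<and> _ \<and> (\<forall>y z. 0 \<le> ?q y z)")
proof -
  have "(\<forall>x. 0 \<le> x \<bullet> (block_matrix A B C D *v x)) \<longleftrightarrow> (\<forall>y z. 0 \<le> ?q y z)"
  proof safe
    fix y z
    assume "\<forall>x. 0 \<le> x \<bullet> (block_matrix A B C D *v x)"
    \<comment> \<open>The witness is the concatenation of y and z; conversely, every x is the
      concatenation of its two parts.\<close>
    then have "0 \<le> (\<chi> i. case_sum (($) y) (($) z) i)
        \<bullet> (block_matrix A B C D *v (\<chi> i. case_sum (($) y) (($) z) i))"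
      by blast
    then show "0 \<le> ?q y z"
      by (simp add: inner_block_matrix)
  qed (simp add: inner_block_matrix)
  then show ?thesis
    by (auto simp: pos_semidef_def transpose_block_matrix block_matrix_eq_iff)
qed

text \<open>Congruence of the block matrix with the block diagonal matrix \<open>diag(V, I)\<close>.\<close>

lemma pos_semidef_block_matrix_congruence:
  fixes R :: "real ^ 'n::finite ^ 'n" and V :: "real ^ 'r::finite ^ 'n"
  assumes "pos_semidef (block_matrix R P C S)"
  shows "pos_semidef (block_matrix (transpose V ** R ** V) (transpose V ** P) (C ** V) S)"
proof -
  have "y \<bullet> ((transpose V ** P) *v z) = (V *v y) \<bullet> (P *v z)" for y z
    by (simp only: inner_matrix_vector_transpose[of y "transpose V"] transpose_transpose
        matrix_vector_mul_assoc[symmetric])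
  moreover have "z \<bullet> ((C ** V) *v y) = z \<bullet> (C *v (V *v y))" for y z
    by (simp flip: matrix_vector_mul_assoc)
  ultimately show ?thesis
    using assms
    by (auto simp: pos_semidef_block_matrix_iff inner_congruence matrix_transpose_mul
        matrix_mul_assoc)
qed

text \<open>Projection is linear, and with \<open>Q = mat 1\<close> nothing stands between
  \<open>J - R\<close> and V, so the form survives. For the output,
  \<open>transpose (B + P) ** V\<close> is the transpose of
  \<open>transpose V ** (B + P)\<close>.\<close>

lemma galerkin_reduction_ph_form:
  "galerkin_reduction V (ph_form E J R (mat 1) B P S N)
     = ph_form (transpose V ** E ** V) (transpose V ** J ** V) (transpose V ** R ** V) (mat 1)
         (transpose V ** B) (transpose V ** P) S N"
  by (simp add: galerkin_reduction_def ph_form_def matrix_diff_ldistrib matrix_diff_rdistrib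
      matrix_add_rdistrib transpose_plus_matrix matrix_transpose_mul)

lemma port_hamiltonian_galerkin:
  assumes "port_hamiltonian \<Sigma> E J R (mat 1) B P S N"
  shows "port_hamiltonian (galerkin_reduction V \<Sigma>)
    (transpose V ** E ** V) (transpose V ** J ** V) (transpose V ** R ** V) (mat 1)
    (transpose V ** B) (transpose V ** P) S N"
proof -
  \<comment> \<open>For \<open>Q = mat 1\<close> the condition concerns \<open>transpose E\<close>,
    and transposition commutes with congruence.\<close>
  have "pos_semidef (transpose (transpose V ** E ** V))"
    using assms pos_semidef_congruence[of "transpose E" V]
    by (simp add: port_hamiltonian_def matrix_transpose_mul matrix_mul_assoc)
  moreover have "pos_semidef (block_matrix (transpose V ** R ** V) (transpose V ** P)
      (transpose (transpose V ** P)) S)"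
    using assms pos_semidef_block_matrix_congruence[of R P "transpose P" S V]
    by (simp add: port_hamiltonian_def matrix_transpose_mul)
  ultimately show ?thesis
    using assms
    by (simp add: port_hamiltonian_def galerkin_reduction_ph_form skew_symmetric_congruence)
qed

text \<open>A matrix and its transpose have the same quadratic form, which reconciles
  \<open>transpose E\<close> in \<open>hamiltonian\<close> with the given formula for
  \<open>Hhat\<close>.\<close>

lemma hamiltonian_mat_1: "hamiltonian E (mat 1) x = 1 / 2 * (x \<bullet> (E *v x))"
  by (simp add: hamiltonian_def inner_matrix_vector_transpose[of x E] inner_commute)

theorem theorem5p2:
  fixes Ehat Jhat Rhat :: "real ^ ('n::finite \<times> 's::finite) ^ ('n \<times> 's)"
    and Bhat Phat :: "real ^ ('m::finite \<times> 's) ^ ('n \<times> 's)"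
    and Shat Nhat :: "real ^ ('m \<times> 's) ^ ('m \<times> 's)"
    and \<Sigma>hat :: "('n \<times> 's, 'm \<times> 's) descriptor_system"
    and Hhat :: "real ^ ('n \<times> 's) \<Rightarrow> real"
    and V :: "real ^ 'r::finite ^ ('n \<times> 's)"
    and Ebar Jbar Rbar :: "real ^ 'r ^ 'r"
    and Bbar Pbar :: "real ^ ('m \<times> 's) ^ 'r"
  assumes "CARD('r) < CARD('n) * CARD('s)"
    and "port_hamiltonian \<Sigma>hat Ehat Jhat Rhat (mat 1) Bhat Phat Shat Nhat"
    and "\<And>v. Hhat v = 1 / 2 * (v \<bullet> (Ehat *v v))"
    and "transpose V ** V = mat 1"
    and "Ebar = transpose V ** Ehat ** V"
    and "Jbar = transpose V ** Jhat ** V"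
    and "Rbar = transpose V ** Rhat ** V"
    and "Bbar = transpose V ** Bhat"
    and "Pbar = transpose V ** Phat"
  shows "hamiltonian Ehat (mat 1) = Hhat \<and>
         galerkin_reduction V \<Sigma>hat = ph_form Ebar Jbar Rbar (mat 1) Bbar Pbar Shat Nhat \<and>
         port_hamiltonian (ph_form Ebar Jbar Rbar (mat 1) Bbar Pbar Shat Nhat)
           Ebar Jbar Rbar (mat 1) Bbar Pbar Shat Nhat \<and>
         (\<forall>v :: real ^ 'r. hamiltonian Ebar (mat 1) v = Hhat (V *v v))"
proof -
  have sys: "\<Sigma>hat = ph_form Ehat Jhat Rhat (mat 1) Bhat Phat Shat Nhat"
    using assms(2) by (simp add: port_hamiltonian_def)
  have red: "galerkin_reduction V \<Sigma>hat = ph_form Ebar Jbar Rbar (mat 1) Bbar Pbar Shat Nhat"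
    unfolding sys assms(5-9) by (rule galerkin_reduction_ph_form)
  have "port_hamiltonian (galerkin_reduction V \<Sigma>hat) Ebar Jbar Rbar (mat 1) Bbar Pbar Shat Nhat"
    unfolding assms(5-9) by (rule port_hamiltonian_galerkin) (rule assms(2))
  then show ?thesis
    by (simp add: red fun_eq_iff hamiltonian_mat_1 assms(3,5) inner_congruence)
qed

end
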